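(* Let $\varepsilon\in(0,1)$ and $\alpha\in[0,\infty]$. Let $\mathbf D_\alpha$ be any quantum extension of the classical Rényi divergence $D_\alpha$, and let $D_H^\varepsilon$ be the hypothesis testing divergence. Define $$\mu_H(\varepsilon,\alpha):=\sup_A\sup_{\rho,\sigma\in\mathfrak D(A)}\Big\{D_H^\varepsilon(\rho\|\sigma)-\mathbf D_\alpha(\rho\|\sigma)\Big\},$$ where the supremum is over all finite-dimensional systems $A$; i.e. $\mu_H(\varepsilon,\alpha)$ is the smallest number such that $D_H^\varepsilon(\rho\|\sigma)\le\mathbf D_\alpha(\rho\|\sigma)+\mu_H(\varepsilon,\alpha)$ for all finite-dimensional $A$ and all $\rho,\sigma\in\mathfrak D(A)$ (and $\mu_H=\infty$ if there is no such finite number). Then $$\mu_H(\varepsilon,\alpha)=\begin{cases}\frac{\alpha}{\alpha-1}\log\left(\frac1{1-\varepsilon}\right)&\text{if }\alpha>1,\\ \infty&\text{otherwise,}\end{cases}$$ where $\frac{\alpha}{\alpha-1}=1$ for $\alpha=\infty$.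
   Context: $\log$ is base 2. Classical Rényi divergence of probability vectors: for $\alpha\in(0,1)\cup(1,\infty)$, $D_\alpha(\mathbf p\|\mathbf q)=\frac1{\alpha-1}\log\sum_x p_x^\alpha q_x^{1-\alpha}$, equal to $\infty$ if $\alpha>1$ and $\mathrm{supp}(\mathbf p)\not\subseteq\mathrm{supp}(\mathbf q)$, or if $\alpha<1$ and the supports are disjoint; by continuity $D_0(\mathbf p\|\mathbf q)=-\log\sum_{x:p_x>0}q_x$, $D_1$ is the Kullback–Leibler divergence, and $D_\infty(\mathbf p\|\mathbf q)=\log\max_{x:p_x>0}p_x/q_x$. $\mathfrak{D}(A)$ is the set of density operators on a finite-dimensional Hilbert space $A$. A quantum divergence is a function $\mathbf D$ on pairs of density operators (in all finite dimensions) with values in $\mathbb R\cup\{\infty\}$ such that $\mathbf D(\mathcal E(\rho)\|\mathcal E(\sigma))\le\mathbf D(\rho\|\sigma)$ for every completely positive trace-preserving map $\mathcal E$. A quantum extension of a classical divergence $D$ is a quantum divergence that coincides with $D$ on commuting (simultaneously diagonal) states. Hypothesis testing divergence: $D_H^\varepsilon(\rho\|\sigma)=-\log\min\{\mathrm{Tr}[\Lambda\sigma]:\mathrm{Tr}[\Lambda\rho]\ge1-\varepsilon,\ 0\le\Lambda\le I_A\}$ (with $-\log 0=\infty$). *)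

theory Defs
  imports "Jordan_Normal_Form.Schur_Decomposition" "HOL-Library.Extended_Real"
begin

section \<open>Classical Renyi divergence\<close>

definition prob_vec :: "nat \<Rightarrow> real vec \<Rightarrow> bool" where
  "prob_vec n p \<longleftrightarrow> p \<in> carrier_vec n \<and> (\<forall>i<n. 0 \<le> p $ i) \<and> (\<Sum>i<n. p $ i) = 1"

definition supp :: "real vec \<Rightarrow> nat set" where
  "supp p = {i. i < dim_vec p \<and> p $ i \<noteq> 0}"

text \<open>For \<open>a > 1\<close> the term with \<open>p $ i = q $ i = 0\<close> is \<open>0\<close>, as it should be, because
  \<open>0 powr a = 0\<close> for every \<open>a\<close>; the other case of \<open>q $ i = 0\<close> is excluded by the support
  condition. The support condition at \<open>\<alpha> = 0\<close>, \<open>1\<close> and \<open>\<infinity>\<close> is the usual convention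
  \<open>- log 0 = \<infinity>\<close>, \<open>log (x / 0) = \<infinity>\<close>.\<close>

definition renyi_div :: "ereal \<Rightarrow> real vec \<Rightarrow> real vec \<Rightarrow> ereal" where
  "renyi_div \<alpha> p q =
    (if (1 \<le> \<alpha> \<and> \<not> supp p \<subseteq> supp q) \<or> (\<alpha> < 1 \<and> supp p \<inter> supp q = {}) then \<infinity>
     else if \<alpha> = 0 then ereal (- log 2 (\<Sum>i\<in>supp p. q $ i))
     else if \<alpha> = 1 then ereal (\<Sum>i\<in>supp p. p $ i * log 2 (p $ i / q $ i))
     else if \<alpha> = \<infinity> then ereal (log 2 (Max ((\<lambda>i. p $ i / q $ i) ` supp p)))
     else (let a = real_of_ereal \<alpha> in
       ereal (1 / (a - 1) * log 2 (\<Sum>i<dim_vec p. (p $ i) powr a * (q $ i) powr (1 - a)))))"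


section \<open>States and channels\<close>

text \<open>A finite-dimensional Hilbert space of dimension \<open>n\<close> is identified with the space of complex
  vectors of length \<open>n\<close>, its operators with the complex \<open>n \<times> n\<close> matrices.\<close>

definition mat_trace :: "complex mat \<Rightarrow> complex" where
  "mat_trace A = (\<Sum>i<dim_row A. A $$ (i, i))"

text \<open>In the order on \<^typ>\<open>complex\<close>, \<open>0 \<le> z\<close> says that \<open>z\<close> is real and nonnegative; hence a
  positive semidefinite matrix is automatically Hermitian.\<close>

definition psd :: "nat \<Rightarrow> complex mat \<Rightarrow> bool" where
  "psd n A \<longleftrightarrow> A \<in> carrier_mat n n \<and> (\<forall>v\<in>carrier_vec n. 0 \<le> (A *\<^sub>v v) \<bullet>c v)"

definition density_op :: "nat \<Rightarrow> complex mat \<Rightarrow> bool" where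
  "density_op n \<rho> \<longleftrightarrow> psd n \<rho> \<and> mat_trace \<rho> = 1"

definition unitary_op :: "nat \<Rightarrow> complex mat \<Rightarrow> bool" where
  "unitary_op n U \<longleftrightarrow>
    U \<in> carrier_mat n n \<and> mat_adjoint U * U = 1\<^sub>m n \<and> U * mat_adjoint U = 1\<^sub>m n"

definition linear_op_map :: "nat \<Rightarrow> nat \<Rightarrow> (complex mat \<Rightarrow> complex mat) \<Rightarrow> bool" where
  "linear_op_map m n E \<longleftrightarrow>
    (\<forall>A\<in>carrier_mat m m. E A \<in> carrier_mat n n) \<and>
    (\<forall>A\<in>carrier_mat m m. \<forall>B\<in>carrier_mat m m. E (A + B) = E A + E B) \<and>
    (\<forall>c. \<forall>A\<in>carrier_mat m m. E (c \<cdot>\<^sub>m A) = c \<cdot>\<^sub>m E A)"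

text \<open>The map \<open>id \<otimes> E\<close> on operators of \<open>k\<close>-dimensional space tensor \<open>m\<close>-dimensional space: a
  \<open>km \<times> km\<close> matrix is a \<open>k \<times> k\<close> array of \<open>m \<times> m\<close> blocks, to each of which \<open>E\<close> is applied.\<close>

definition ampliation ::
  "nat \<Rightarrow> nat \<Rightarrow> nat \<Rightarrow> (complex mat \<Rightarrow> complex mat) \<Rightarrow> complex mat \<Rightarrow> complex mat" where
  "ampliation k m n E X = mat (k * n) (k * n) (\<lambda>(r, s).
     E (mat m m (\<lambda>(a, b). X $$ ((r div n) * m + a, (s div n) * m + b))) $$ (r mod n, s mod n))"

definition completely_positive :: "nat \<Rightarrow> nat \<Rightarrow> (complex mat \<Rightarrow> complex mat) \<Rightarrow> bool" where
  "completely_positive m n E \<longleftrightarrow> (\<forall>k X. psd (k * m) X \<longrightarrow> psd (k * n) (ampliation k m n E X))"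

definition cptp :: "nat \<Rightarrow> nat \<Rightarrow> (complex mat \<Rightarrow> complex mat) \<Rightarrow> bool" where
  "cptp m n E \<longleftrightarrow> linear_op_map m n E \<and> completely_positive m n E \<and>
    (\<forall>A\<in>carrier_mat m m. mat_trace (E A) = mat_trace A)"


section \<open>Quantum divergences\<close>

text \<open>Only the values on pairs of density operators of equal dimension matter.\<close>

definition quantum_divergence :: "(complex mat \<Rightarrow> complex mat \<Rightarrow> ereal) \<Rightarrow> bool" where
  "quantum_divergence D \<longleftrightarrow>
    (\<forall>n \<rho> \<sigma>. density_op n \<rho> \<longrightarrow> density_op n \<sigma> \<longrightarrow> D \<rho> \<sigma> \<noteq> -\<infinity>) \<and>
    (\<forall>m n E \<rho> \<sigma>. cptp m n E \<longrightarrow> density_op m \<rho> \<longrightarrow> density_op m \<sigma> \<longrightarrow> D (E \<rho>) (E \<sigma>) \<le> D \<rho> \<sigma>)"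

text \<open>The operator with eigenvalues \<open>p\<close> and the columns of \<open>U\<close> as eigenvectors. A pair of density
  operators is simultaneously diagonal iff it has the form \<open>diag_state n U p\<close>, \<open>diag_state n U q\<close>
  with \<open>U\<close> unitary and \<open>p\<close>, \<open>q\<close> probability vectors.\<close>

definition diag_state :: "nat \<Rightarrow> complex mat \<Rightarrow> real vec \<Rightarrow> complex mat" where
  "diag_state n U p = U * mat_diag n (\<lambda>i. complex_of_real (p $ i)) * mat_adjoint U"

definition quantum_extension ::
  "(real vec \<Rightarrow> real vec \<Rightarrow> ereal) \<Rightarrow> (complex mat \<Rightarrow> complex mat \<Rightarrow> ereal) \<Rightarrow> bool" where
  "quantum_extension C D \<longleftrightarrow> quantum_divergence D \<and>
    (\<forall>n U p q. unitary_op n U \<longrightarrow> prob_vec n p \<longrightarrow> prob_vec n q \<longrightarrow>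
       D (diag_state n U p) (diag_state n U q) = C p q)"

text \<open>The minimum in the definition of the hypothesis testing divergence is over a nonempty compact
  set, so that it equals the infimum.\<close>

definition hyp_test_min :: "real \<Rightarrow> complex mat \<Rightarrow> complex mat \<Rightarrow> real" where
  "hyp_test_min \<epsilon> \<rho> \<sigma> = Inf {Re (mat_trace (L * \<sigma>)) | L.
     psd (dim_row \<rho>) L \<and> psd (dim_row \<rho>) (1\<^sub>m (dim_row \<rho>) - L) \<and> 1 - \<epsilon> \<le> Re (mat_trace (L * \<rho>))}"

definition hyp_test_div :: "real \<Rightarrow> complex mat \<Rightarrow> complex mat \<Rightarrow> ereal" where
  "hyp_test_div \<epsilon> \<rho> \<sigma> =
    (if hyp_test_min \<epsilon> \<rho> \<sigma> = 0 then \<infinity> else ereal (- log 2 (hyp_test_min \<epsilon> \<rho> \<sigma>)))"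

text \<open>The difference \<open>x - y\<close>, except that \<open>\<infinity> - \<infinity>\<close>, which is \<open>\<infinity>\<close> in \<^typ>\<open>ereal\<close>, is read as
  \<open>-\<infinity>\<close>: a pair of states with infinite divergence must not contribute to the supremum below.\<close>

definition excess :: "ereal \<Rightarrow> ereal \<Rightarrow> ereal" where
  "excess x y = (if y = \<infinity> then -\<infinity> else x - y)"

definition mu_H :: "real \<Rightarrow> (complex mat \<Rightarrow> complex mat \<Rightarrow> ereal) \<Rightarrow> ereal" where
  "mu_H \<epsilon> D = Sup {excess (hyp_test_div \<epsilon> \<rho> \<sigma>) (D \<rho> \<sigma>) | n \<rho> \<sigma>. density_op n \<rho> \<and> density_op n \<sigma>}"

lemma excess_le_iff:
  assumes "y \<noteq> -\<infinity>"
  shows "excess x y \<le> c \<longleftrightarrow> x \<le> y + c"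
  using assms by (cases x; cases y; cases c) (auto simp: excess_def)

text \<open>Thus \<^const>\<open>mu_H\<close> is the smallest \<open>c\<close> that bounds the hypothesis testing divergence by
  \<open>D + c\<close>.\<close>

lemma mu_H_le_iff:
  assumes "quantum_divergence D"
  shows "mu_H \<epsilon> D \<le> c \<longleftrightarrow>
    (\<forall>n \<rho> \<sigma>. density_op n \<rho> \<longrightarrow> density_op n \<sigma> \<longrightarrow> hyp_test_div \<epsilon> \<rho> \<sigma> \<le> D \<rho> \<sigma> + c)"
proof -
  have "D \<rho> \<sigma> \<noteq> -\<infinity>" if "density_op n \<rho>" "density_op n \<sigma>" for n \<rho> \<sigma>
    using assms that unfolding quantum_divergence_def by blast
  then show ?thesis
    unfolding mu_H_def Sup_le_iff by (smt (verit) excess_le_iff mem_Collect_eq)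
qed

end

theory Submission
  imports Defs
begin

text \<open>For \<open>\<alpha> > 1\<close>, measuring with a test \<open>L\<close> is a channel onto binary distributions \<open>(a, 1 - a)\<close> and
  \<open>(b, 1 - b)\<close> with \<open>a \<ge> 1 - \<epsilon>\<close>. By data processing the divergence of the states dominates the
  classical one, which by dropping the second outcome is at least
  \<open>\<alpha> / (\<alpha> - 1) * log a - log b\<close>; this is the upper bound. It is sharp, and \<open>\<infinity>\<close> is attained for
  \<open>\<alpha> \<le> 1\<close>, on the commuting states \<open>(1 - \<epsilon>, \<epsilon>)\<close> and \<open>(b, 1 - b)\<close> with \<open>b \<longlongrightarrow> 0\<close>
  (for \<open>\<alpha> < 1\<close> already with \<open>b = 0\<close>, for \<open>\<alpha> = \<infinity>\<close> with \<open>b = 1 - \<epsilon>\<close>). Complete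
  positivity of the measurement channel comes down to \<open>Tr (A B) \<ge> 0\<close> for positive semidefinite
  \<open>A\<close> and \<open>B\<close>, which is proved by induction on the dimension via the Schur complement of \<open>A\<close>.\<close>

section \<open>Positive semidefinite forms\<close>

lemma complex_nonnegE:
  assumes "0 \<le> (z :: complex)"
  obtains r where "z = complex_of_real r" "0 \<le> r"
  using assms that[of "Re z"] by (auto simp: less_eq_complex_def complex_eq_iff)

text \<open>Entries are given by a function rather than a matrix, so that passing to a leading block
  keeps the same function and block indices such as \<open>i * m + a\<close> can be substituted
  directly.\<close>

definition qform :: "nat \<Rightarrow> (nat \<Rightarrow> nat \<Rightarrow> complex) \<Rightarrow> (nat \<Rightarrow> complex) \<Rightarrow> complex" where
  "qform n A v = (\<Sum>i<n. \<Sum>j<n. cnj (v i) * A i j * v j)"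

definition pos_form :: "nat \<Rightarrow> (nat \<Rightarrow> nat \<Rightarrow> complex) \<Rightarrow> bool" where
  "pos_form n A \<longleftrightarrow> (\<forall>v. 0 \<le> qform n A v)"

lemma psd_iff_pos_form:
  "psd n A \<longleftrightarrow> A \<in> carrier_mat n n \<and> pos_form n (\<lambda>i j. A $$ (i, j))"
proof -
  have eq: "(A *\<^sub>v v) \<bullet>c v = qform n (\<lambda>i j. A $$ (i, j)) (\<lambda>i. v $ i)"
    if "A \<in> carrier_mat n n" "v \<in> carrier_vec n" for v
    using that by (auto simp: qform_def scalar_prod_def sum_distrib_right sum_distrib_left
        atLeast0LessThan mult_ac intro!: sum.cong)
  \<comment> \<open>Only values of \<open>v\<close> below \<open>n\<close> enter, so functions and
    vectors of length \<open>n\<close> impose the same condition.\<close>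
  have cong: "qform n B v = qform n B (\<lambda>i. vec n v $ i)" for B v
    unfolding qform_def by (intro sum.cong) auto
  show ?thesis
    unfolding psd_def pos_form_def using eq cong by (metis vec_carrier)
qed

lemma qform_two_points:
  assumes "i < n" "j < n" "i \<noteq> j"
  shows "qform n A (\<lambda>k. if k = i then c else if k = j then d else 0) =
    cnj c * A i i * c + cnj c * A i j * d + cnj d * A j i * c + cnj d * A j j * d"
proof -
  let ?v = "\<lambda>k. if k = i then c else if k = j then d else 0"
  have *: "(\<Sum>k<n. f k) = f i + f j" if "\<And>k. k \<noteq> i \<Longrightarrow> k \<noteq> j \<Longrightarrow> f k = 0" for f :: "nat \<Rightarrow> complex"
  proof -
    have "(\<Sum>k<n. f k) = (\<Sum>k\<in>{i, j}. f k)"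
      by (rule sum.mono_neutral_right) (use assms that in auto)
    then show ?thesis using assms by simp
  qed
  have "qform n A ?v = (\<Sum>k<n. cnj (?v k) * A k i * ?v i + cnj (?v k) * A k j * ?v j)"
    unfolding qform_def by (intro sum.cong refl *) auto
  also have "\<dots> = (cnj (?v i) * A i i * ?v i + cnj (?v i) * A i j * ?v j) +
      (cnj (?v j) * A j i * ?v i + cnj (?v j) * A j j * ?v j)"
    by (rule *) auto
  finally show ?thesis using assms by (simp add: add_ac)
qed

text \<open>Positivity of the 2 by 2 principal submatrices; suitable \<open>c\<close> and
  \<open>d\<close> give Hermitian symmetry and the vanishing of columns with zero diagonal.\<close>

lemma pos_form_two_points:
  assumes "pos_form n A" "i < n" "j < n" "i \<noteq> j"
  shows "0 \<le> cnj c * A i i * c + cnj c * A i j * d + cnj d * A j i * c + cnj d * A j j * d"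
  unfolding qform_two_points[OF assms(2-4), symmetric] using assms(1) by (simp add: pos_form_def)

lemma pos_form_diag:
  assumes "pos_form n A" "i < n"
  shows "0 \<le> A i i"
proof -
  have "qform n A (\<lambda>k. if k = i then 1 else 0) = (\<Sum>k<n. if k = i then A i i else 0)"
    unfolding qform_def using assms(2)
    by (intro sum.cong refl) (auto simp: if_distrib cong: if_cong)
  moreover have "0 \<le> qform n A (\<lambda>k. if k = i then 1 else 0)"
    using assms(1) unfolding pos_form_def by blast
  ultimately show ?thesis using assms(2) by simp
qed

text \<open>Diagonal entries are real. The vector (1, 1) then makes the imaginary parts of
  \<open>A i j\<close> and \<open>A j i\<close> cancel, and (1, \<i>) makes their real parts
  equal.\<close>

lemma pos_form_hermitian:
  assumes "pos_form n A" "i < n" "j < n"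
  shows "A j i = cnj (A i j)"
proof (cases "i = j")
  case True
  then show ?thesis using pos_form_diag[OF assms(1,2)]
    by (auto simp: complex_eq_iff less_eq_complex_def)
next
  case False
  note q = pos_form_two_points[OF assms False]
  show ?thesis
    using q[of 1 1] q[of 1 \<i>] pos_form_diag[OF assms(1,2)] pos_form_diag[OF assms(1,3)]
    by (auto simp: complex_eq_iff less_eq_complex_def)
qed

lemma pos_form_diag_zero:
  assumes "pos_form n A" "i < n" "j < n" "A j j = 0"
  shows "A i j = 0"
proof (rule ccontr)
  assume nz: "A i j \<noteq> 0"
  then have ij: "i \<noteq> j" using assms(4) by auto
  obtain r where r: "A i i = complex_of_real r" "0 \<le> r"
    using pos_form_diag[OF assms(1,2)] by (rule complex_nonnegE)
  \<comment> \<open>Moving from the basis vector at \<open>j\<close> by \<open>c\<close> in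
    direction \<open>i\<close> gives the value \<open>s * (s * r - 2)\<close> times the squared
    modulus of \<open>A i j\<close>, negative for small \<open>s > 0\<close>. The summand 1 covers
    \<open>r = 0\<close>.\<close>
  define s where "s = 1 / (r + 1)"
  define c where "c = - complex_of_real s * A i j"
  have "0 \<le> cnj c * A i i * c + cnj c * A i j * 1 + cnj 1 * A j i * c + cnj 1 * A j j * 1"
    by (rule pos_form_two_points[OF assms(1-3) ij])
  also have "\<dots> = complex_of_real ((s * r - 2) * (s * (cmod (A i j))\<^sup>2))"
  proof -
    have "\<dots> = complex_of_real ((s * r - 2) * s) * (A i j * cnj (A i j))"
      using pos_form_hermitian[OF assms(1-3)] assms(4) r(1) by (simp add: c_def algebra_simps)
    then show ?thesis by (simp only: flip: complex_norm_square) (simp add: mult_ac)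
  qed
  finally have "0 \<le> (s * r - 2) * (s * (cmod (A i j))\<^sup>2)"
    by (simp only: less_eq_complex_def complex.sel Re_complex_of_real zero_complex.sel)
  moreover have "0 < s * (cmod (A i j))\<^sup>2" using nz r(2) by (simp add: s_def)
  moreover have "s * r < 2" using r(2) by (simp add: s_def field_simps)
  ultimately show False by (simp add: mult_less_0_iff zero_le_mult_iff)
qed

lemma pos_form_restrict:
  assumes "pos_form (Suc n) A"
  shows "pos_form n A"
  unfolding pos_form_def
proof
  fix v
  have "qform n A v = qform (Suc n) A (v(n := 0))"
    by (auto simp: qform_def intro!: sum.cong)
  then show "0 \<le> qform n A v" using assms by (simp add: pos_form_def)
qed

text \<open>The Schur complement. If \<open>A n n = 0\<close> then the subtracted term is \<open>0\<close> by the convention on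
  division, which is right because then \<open>A i n = 0\<close> for all \<open>i\<close>.\<close>

lemma pos_form_schur:
  assumes "pos_form (Suc n) A"
  shows "pos_form n (\<lambda>i j. A i j - A i n * A n j / A n n)"
proof (cases "A n n = 0")
  case True
  then show ?thesis using pos_form_restrict[OF assms] by simp
next
  case False
  show ?thesis
    unfolding pos_form_def
  proof
    fix v
    define s where "s = (\<Sum>j<n. A n j * v j)"
    \<comment> \<open>Completing the square: at this last coordinate the form of \<open>A\<close>
      takes exactly the value of the Schur complement at \<open>v\<close>.\<close>
    define t where "t = - s / A n n"
    have herm: "A i n = cnj (A n i)" if "i \<le> n" for i
      using pos_form_hermitian[OF assms, of n i] that by auto
    have cs: "cnj s = (\<Sum>i<n. cnj (v i) * A i n)"
      unfolding s_def by (auto simp: herm mult_ac intro!: sum.cong)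
    have "qform n (\<lambda>i j. A i j - A i n * A n j / A n n) v =
        qform n A v - (\<Sum>i<n. \<Sum>j<n. (cnj (v i) * A i n) * (A n j * v j)) / A n n"
      by (simp add: qform_def algebra_simps sum_subtractf sum_divide_distrib)
    also have "\<dots> = qform n A v - cnj s * s / A n n"
      by (simp only: cs, simp only: s_def sum_product)
    also have "\<dots> = qform n A v + cnj s * t + cnj t * s + cnj t * A n n * t"
      using False herm[of n, symmetric] by (simp add: t_def)
    also have "\<dots> = qform (Suc n) A (v(n := t))"
    proof -
      have "qform (Suc n) A (v(n := t)) = (\<Sum>i<n. (\<Sum>j<n. cnj (v i) * A i j * v j) + cnj (v i) * A i n * t)
          + ((\<Sum>j<n. cnj t * A n j * v j) + cnj t * A n n * t)"
        by (simp add: qform_def)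
      also have "\<dots> = qform n A v + cnj s * t + cnj t * s + cnj t * A n n * t"
        unfolding cs by (simp add: qform_def s_def sum.distrib sum_distrib_left sum_distrib_right mult_ac)
      finally show ?thesis by simp
    qed
    finally show "0 \<le> qform n (\<lambda>i j. A i j - A i n * A n j / A n n) v"
      using assms by (simp add: pos_form_def)
  qed
qed

text \<open>Splitting off the rank-one part of \<open>A\<close> through its last column leaves
  \<open>A'\<close>, which lives in size \<open>n\<close>. The rank-one part contributes the form of
  \<open>B\<close> at that column, divided by the pivot \<open>A n n\<close>.\<close>

lemma pos_form_trace_mult:
  assumes "pos_form n A" "pos_form n B"
  shows "0 \<le> (\<Sum>i<n. \<Sum>j<n. A i j * B j i)"
  using assms
proof (induction n arbitrary: A)
  case 0
  then show ?case by simp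
next
  case (Suc n)
  define A' where "A' i j = A i j - A i n * A n j / A n n" for i j
  have herm: "A n i = cnj (A i n)" if "i \<le> n" for i
    using pos_form_hermitian[OF Suc.prems(1), of i n] that by auto
  have z: "A i n = 0" if "A n n = 0" "i \<le> n" for i
    using pos_form_diag_zero[OF Suc.prems(1), of i n] that by simp
  have z': "A n i = 0" if "A n n = 0" "i \<le> n" for i
    unfolding herm[OF that(2)] z[OF that] by simp
  \<comment> \<open>For a zero pivot nothing is subtracted, but the last row and column of
    \<open>A\<close> vanish already.\<close>
  have A'0: "A' i n = 0" "A' n i = 0" if "i \<le> n" for i
    using z[OF _ that] z'[OF _ that] by (cases "A n n = 0"; simp add: A'_def)+
  have "(\<Sum>i<Suc n. \<Sum>j<Suc n. A i j * B j i) =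
      (\<Sum>i<Suc n. \<Sum>j<Suc n. A' i j * B j i) + (\<Sum>i<Suc n. \<Sum>j<Suc n. cnj (A j n) * B j i * A i n) / A n n"
    unfolding sum_divide_distrib sum.distrib[symmetric]
  proof (intro sum.cong refl)
    fix i j assume "i \<in> {..<Suc n}" "j \<in> {..<Suc n}"
    then have "cnj (A j n) = A n j" using herm[of j] by simp
    then show "A i j * B j i = A' i j * B j i + cnj (A j n) * B j i * A i n / A n n"
      by (simp add: A'_def algebra_simps)
  qed
  also have "(\<Sum>i<Suc n. \<Sum>j<Suc n. cnj (A j n) * B j i * A i n) = qform (Suc n) B (\<lambda>i. A i n)"
    unfolding qform_def by (rule sum.swap)
  also have "(\<Sum>i<Suc n. \<Sum>j<Suc n. A' i j * B j i) = (\<Sum>i<n. \<Sum>j<n. A' i j * B j i)"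
    by (simp add: A'0)
  finally have eq: "(\<Sum>i<Suc n. \<Sum>j<Suc n. A i j * B j i) =
      (\<Sum>i<n. \<Sum>j<n. A' i j * B j i) + qform (Suc n) B (\<lambda>i. A i n) / A n n" .
  have "0 \<le> (\<Sum>i<n. \<Sum>j<n. A' i j * B j i)"
    using Suc.IH[of A'] pos_form_schur[OF Suc.prems(1)] pos_form_restrict[OF Suc.prems(2)]
    by (simp add: A'_def[abs_def])
  moreover have "0 \<le> qform (Suc n) B (\<lambda>i. A i n) / A n n"
  proof -
    obtain x where "qform (Suc n) B (\<lambda>i. A i n) = complex_of_real x" "0 \<le> x"
      using Suc.prems(2) unfolding pos_form_def by (meson complex_nonnegE)
    moreover obtain y where "A n n = complex_of_real y" "0 \<le> y"
      using pos_form_diag[OF Suc.prems(1) lessI] by (rule complex_nonnegE)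
    ultimately show ?thesis by (simp add: less_eq_complex_def flip: of_real_divide)
  qed
  ultimately show ?case unfolding eq by (rule add_nonneg_nonneg)
qed

lemma mat_trace_mult:
  assumes "A \<in> carrier_mat n n" "B \<in> carrier_mat n n"
  shows "mat_trace (A * B) = (\<Sum>i<n. \<Sum>j<n. A $$ (i, j) * B $$ (j, i))"
  using assms by (auto simp: mat_trace_def scalar_prod_def atLeast0LessThan intro!: sum.cong)

lemma psd_trace_mult:
  assumes "psd n A" "psd n B"
  shows "0 \<le> mat_trace (A * B)"
  using assms pos_form_trace_mult[of n "\<lambda>i j. A $$ (i, j)" "\<lambda>i j. B $$ (i, j)"]
  by (auto simp: psd_iff_pos_form mat_trace_mult)

lemma mat_trace_mat_diag: "mat_trace (mat_diag n f) = (\<Sum>i<n. f i)"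
  by (simp add: mat_trace_def mat_diag_def)


section \<open>Two-outcome measurements\<close>

text \<open>The measurement with effects \<open>L\<close> and \<open>1 - L\<close>. Recording the
  outcome on a diagonal makes all outputs commute, so that a quantum extension is classical on
  them.\<close>

definition test_channel :: "complex mat \<Rightarrow> complex mat \<Rightarrow> complex mat" where
  "test_channel L X = mat_diag 2 (\<lambda>i. mat_trace ((if i = 0 then L else 1\<^sub>m (dim_row L) - L) * X))"

text \<open>Division with remainder, \<open>r = i * m + a\<close>: the indexing of blocks in
  \<open>ampliation\<close>.\<close>

lemma sum_blocks:
  fixes f :: "nat \<Rightarrow> 'a::comm_monoid_add"
  shows "(\<Sum>r<k * m. f r) = (\<Sum>i<k. \<Sum>a<m. f (i * m + a))"
proof (induction k)
  case (Suc k)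
  have "(\<Sum>r<m + k * m. f r) = (\<Sum>r<k * m. f r) + (\<Sum>r = k * m..<k * m + m. f r)"
    by (simp add: add.commute lessThan_atLeast0 sum.atLeastLessThan_concat)
  also have "(\<Sum>r = k * m..<k * m + m. f r) = (\<Sum>a<m. f (k * m + a))"
    using sum.shift_bounds_nat_ivl[of f 0 "k * m" m] by (simp add: lessThan_atLeast0 add.commute)
  finally show ?case using Suc by simp
qed simp

text \<open>The value at \<open>u\<close> is the form of \<open>X\<close> at the tensor product of
  \<open>w\<close> and \<open>u\<close>.\<close>

lemma pos_form_compress:
  assumes "pos_form (k * m) X"
  shows "pos_form m (\<lambda>a b. \<Sum>i<k. \<Sum>j<k. cnj (w i) * X (i * m + a) (j * m + b) * w j)"
  unfolding pos_form_def
proof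
  fix u
  define v where "v r = w (r div m) * u (r mod m)" for r
  have "qform m (\<lambda>a b. \<Sum>i<k. \<Sum>j<k. cnj (w i) * X (i * m + a) (j * m + b) * w j) u =
      (\<Sum>a<m. \<Sum>b<m. \<Sum>i<k. \<Sum>j<k. cnj (w i * u a) * X (i * m + a) (j * m + b) * (w j * u b))"
    by (simp add: qform_def sum_distrib_left sum_distrib_right mult_ac)
  \<comment> \<open>The exchanges bring the sums into the order \<open>i\<close>, \<open>a\<close>,
    \<open>j\<close>, \<open>b\<close> that \<open>sum_blocks\<close> produces.\<close>
  also have "\<dots> = (\<Sum>a<m. \<Sum>i<k. \<Sum>b<m. \<Sum>j<k. cnj (w i * u a) * X (i * m + a) (j * m + b) * (w j * u b))"
    by (intro sum.cong refl sum.swap)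
  also have "\<dots> = (\<Sum>i<k. \<Sum>a<m. \<Sum>b<m. \<Sum>j<k. cnj (w i * u a) * X (i * m + a) (j * m + b) * (w j * u b))"
    by (rule sum.swap)
  also have "\<dots> = (\<Sum>i<k. \<Sum>a<m. \<Sum>j<k. \<Sum>b<m. cnj (w i * u a) * X (i * m + a) (j * m + b) * (w j * u b))"
    by (intro sum.cong refl sum.swap)
  also have "\<dots> = qform (k * m) X v"
    unfolding qform_def sum_blocks by (intro sum.cong refl) (auto simp: v_def)
  finally show "0 \<le> qform m (\<lambda>a b. \<Sum>i<k. \<Sum>j<k. cnj (w i) * X (i * m + a) (j * m + b) * w j) u"
    using assms by (simp add: pos_form_def)
qed

text \<open>The value at \<open>w\<close> is the trace of \<open>L\<close> times the compression of
  \<open>X\<close> by \<open>w\<close>, a product of two positive operators.\<close>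

lemma pos_form_partial_trace:
  assumes L: "psd m L" and X: "psd (k * m) X"
  shows "pos_form k (\<lambda>i j. mat_trace (L * mat m m (\<lambda>(a, b). X $$ (i * m + a, j * m + b))))"
  unfolding pos_form_def
proof
  fix w
  let ?Y = "\<lambda>a b. \<Sum>i<k. \<Sum>j<k. cnj (w i) * X $$ (i * m + a, j * m + b) * w j"
  have Lc: "L \<in> carrier_mat m m" using L by (simp add: psd_def)
  have "qform k (\<lambda>i j. mat_trace (L * mat m m (\<lambda>(a, b). X $$ (i * m + a, j * m + b)))) w =
      (\<Sum>i<k. \<Sum>j<k. \<Sum>a<m. \<Sum>b<m. L $$ (a, b) * (cnj (w i) * X $$ (i * m + b, j * m + a) * w j))"
    by (auto simp: qform_def mat_trace_mult[OF Lc] sum_distrib_left sum_distrib_right mult_ac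
        intro!: sum.cong)
  also have "\<dots> = (\<Sum>i<k. \<Sum>a<m. \<Sum>j<k. \<Sum>b<m. L $$ (a, b) * (cnj (w i) * X $$ (i * m + b, j * m + a) * w j))"
    by (intro sum.cong refl sum.swap)
  also have "\<dots> = (\<Sum>a<m. \<Sum>i<k. \<Sum>j<k. \<Sum>b<m. L $$ (a, b) * (cnj (w i) * X $$ (i * m + b, j * m + a) * w j))"
    by (rule sum.swap)
  also have "\<dots> = (\<Sum>a<m. \<Sum>i<k. \<Sum>b<m. \<Sum>j<k. L $$ (a, b) * (cnj (w i) * X $$ (i * m + b, j * m + a) * w j))"
    by (intro sum.cong refl sum.swap)
  also have "\<dots> = (\<Sum>a<m. \<Sum>b<m. \<Sum>i<k. \<Sum>j<k. L $$ (a, b) * (cnj (w i) * X $$ (i * m + b, j * m + a) * w j))"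
    by (intro sum.cong refl sum.swap)
  also have "\<dots> = (\<Sum>a<m. \<Sum>b<m. L $$ (a, b) * ?Y b a)"
    by (simp add: sum_distrib_left)
  also have "0 \<le> \<dots>"
    using L X pos_form_compress[of k m "\<lambda>r s. X $$ (r, s)" w]
    by (intro pos_form_trace_mult) (auto simp: psd_iff_pos_form)
  finally show "0 \<le> qform k (\<lambda>i j. mat_trace (L * mat m m (\<lambda>(a, b). X $$ (i * m + a, j * m + b)))) w" .
qed

lemma test_channel_cptp:
  assumes L: "psd m L" and L': "psd m (1\<^sub>m m - L)"
  shows "cptp m 2 (test_channel L)"
proof -
  have Lc: "L \<in> carrier_mat m m" using L by (simp add: psd_def)
  then have dL: "dim_row L = m" by simp
  define K where "K c = (if c = 0 then L else 1\<^sub>m m - L)" for c :: nat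
  have Kc: "K c \<in> carrier_mat m m" for c using Lc by (auto simp: K_def)
  have K: "psd m (K c)" for c using L L' by (simp add: K_def)
  have E: "test_channel L X = mat_diag 2 (\<lambda>i. mat_trace (K i * X))" for X
    unfolding test_channel_def K_def dL ..
  have tr: "mat_trace (test_channel L A) = mat_trace A" if A: "A \<in> carrier_mat m m" for A
  proof -
    have "mat_trace (test_channel L A) = mat_trace (K 0 * A) + mat_trace (K 1 * A)"
      by (simp add: E mat_trace_mat_diag numeral_2_eq_2)
    \<comment> \<open>The two effects add up to the identity.\<close>
    also have "\<dots> = (\<Sum>i<m. \<Sum>j<m. (if i = j then A $$ (j, i) else 0))"
      unfolding mat_trace_mult[OF Kc A] sum.distrib[symmetric] using Lc
      by (intro sum.cong refl) (auto simp: K_def algebra_simps)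
    also have "\<dots> = mat_trace A"
      using A by (auto simp: mat_trace_def intro!: sum.cong)
    finally show ?thesis .
  qed
  have lin: "linear_op_map m 2 (test_channel L)"
    unfolding linear_op_map_def
  proof (intro conjI ballI allI)
    fix A B :: "complex mat" and c :: complex assume A: "A \<in> carrier_mat m m"
    show "test_channel L A \<in> carrier_mat 2 2" by (simp add: E)
    show "test_channel L (c \<cdot>\<^sub>m A) = c \<cdot>\<^sub>m test_channel L A"
      using A by (intro eq_matI) (auto simp: E mat_diag_def mat_trace_mult[OF Kc] sum_distrib_left mult_ac
          intro!: sum.cong)
    assume B: "B \<in> carrier_mat m m"
    show "test_channel L (A + B) = test_channel L A + test_channel L B"
    proof -
      have "mat_trace (K i * (A + B)) = mat_trace (K i * A) + mat_trace (K i * B)" for i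
        using A B by (simp add: mat_trace_mult[OF Kc] distrib_left sum.distrib)
      then show ?thesis by (intro eq_matI) (auto simp: E mat_diag_def)
    qed
  qed
  have "psd (k * 2) (ampliation k m 2 (test_channel L) X)" if X: "psd (k * m) X" for k X
  proof -
    let ?T = "\<lambda>c i j. mat_trace (K c * mat m m (\<lambda>(a, b). X $$ (i * m + a, j * m + b)))"
    let ?Z = "ampliation k m 2 (test_channel L) X"
    \<comment> \<open>The ampliated output is block diagonal in the outcome \<open>c\<close>, so its
      form is a sum of two partial trace forms.\<close>
    have Z: "?Z $$ (i * 2 + c, j * 2 + d) = (if c = d then ?T c i j else 0)"
      if "i < k" "j < k" "c < 2" "d < 2" for i j c d
      using that by (auto simp: ampliation_def E mat_diag_def)
    have "0 \<le> qform (k * 2) (\<lambda>i j. ?Z $$ (i, j)) v" for v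
    proof -
      have "qform (k * 2) (\<lambda>i j. ?Z $$ (i, j)) v =
          (\<Sum>i<k. \<Sum>c<2. \<Sum>j<k. \<Sum>d<2. cnj (v (i * 2 + c)) * (if c = d then ?T c i j else 0) * v (j * 2 + d))"
        unfolding qform_def sum_blocks by (intro sum.cong refl) (simp add: Z)
      also have "\<dots> = (\<Sum>i<k. \<Sum>c<2. \<Sum>j<k. cnj (v (i * 2 + c)) * ?T c i j * v (j * 2 + c))"
        by (intro sum.cong refl) (simp add: if_distrib if_distribR cong: if_cong)
      also have "\<dots> = (\<Sum>c<2. qform k (?T c) (\<lambda>i. v (i * 2 + c)))"
        unfolding qform_def by (rule sum.swap)
      also have "0 \<le> \<dots>"
        using pos_form_partial_trace[OF K X] by (intro sum_nonneg) (auto simp: pos_form_def)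
      finally show ?thesis .
    qed
    then show ?thesis by (simp add: psd_iff_pos_form pos_form_def ampliation_def)
  qed
  then show ?thesis
    using lin tr by (auto simp: cptp_def completely_positive_def)
qed

section \<open>Diagonal states and the outcome distributions of tests\<close>

definition bern :: "real \<Rightarrow> real vec" where
  "bern a = vec 2 (\<lambda>i. if i = 0 then a else 1 - a)"

definition diag_op :: "nat \<Rightarrow> real vec \<Rightarrow> complex mat" where
  "diag_op n p = mat_diag n (\<lambda>i. complex_of_real (p $ i))"

lemma prob_vec_bern: "0 \<le> a \<Longrightarrow> a \<le> 1 \<Longrightarrow> prob_vec 2 (bern a)"
  by (auto simp: prob_vec_def bern_def numeral_2_eq_2)

lemma mat_adjoint_one: "mat_adjoint (1\<^sub>m n :: complex mat) = 1\<^sub>m n"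
  by (intro eq_matI) (auto simp: mat_adjoint_def mat_of_rows_def)

lemma unitary_op_one: "unitary_op n (1\<^sub>m n)"
  by (simp add: unitary_op_def mat_adjoint_one)

lemma diag_state_one: "diag_state n (1\<^sub>m n) p = diag_op n p"
  by (simp add: diag_state_def diag_op_def mat_adjoint_one left_mult_one_mat[where nr = n and nc = n]
      right_mult_one_mat[where nr = n and nc = n])

lemma quantum_extension_diag_op:
  assumes "quantum_extension C D" "prob_vec n p" "prob_vec n q"
  shows "D (diag_op n p) (diag_op n q) = C p q"
  using assms unitary_op_one by (metis diag_state_one quantum_extension_def)

lemma psd_mat_diag:
  assumes "\<And>i. i < n \<Longrightarrow> 0 \<le> f i"
  shows "psd n (mat_diag n f)"
proof -
  have "qform n (\<lambda>i j. mat_diag n f $$ (i, j)) v = (\<Sum>i<n. f i * (cnj (v i) * v i))" for v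
    unfolding qform_def
    by (intro sum.cong refl) (simp add: mat_diag_def if_distrib if_distribR mult_ac cong: if_cong)
  moreover have "0 \<le> (\<Sum>i<n. f i * (cnj (v i) * v i))" for v
  proof (rule sum_nonneg)
    fix i assume "i \<in> {..<n}"
    moreover have "0 \<le> cnj (v i) * v i" by (simp add: less_eq_complex_def)
    ultimately show "0 \<le> f i * (cnj (v i) * v i)" using assms mult_nonneg_nonneg by blast
  qed
  ultimately show ?thesis by (simp add: psd_iff_pos_form pos_form_def)
qed

lemma density_op_diag_op:
  assumes "prob_vec n p"
  shows "density_op n (diag_op n p)"
proof -
  have "mat_trace (diag_op n p) = complex_of_real (\<Sum>i<n. p $ i)"
    by (simp add: diag_op_def mat_trace_mat_diag)
  moreover have "psd n (diag_op n p)"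
    unfolding diag_op_def
    by (rule psd_mat_diag) (use assms in \<open>auto simp: prob_vec_def less_eq_complex_def\<close>)
  ultimately show ?thesis
    using assms by (simp add: density_op_def prob_vec_def del: of_real_sum)
qed

text \<open>The channel sends both states to diagonal ones, where \<open>D\<close> equals
  \<open>C\<close>, and monotonicity of \<open>D\<close> gives the inequality. Trace preservation
  makes the outcomes probability distributions.\<close>

lemma test_data_processing:
  assumes D: "quantum_extension C D" and rho: "density_op n \<rho>" and sigma: "density_op n \<sigma>"
    and L: "psd n L" "psd n (1\<^sub>m n - L)"
  defines "a \<equiv> Re (mat_trace (L * \<rho>))" and "b \<equiv> Re (mat_trace (L * \<sigma>))"
  shows "0 \<le> a" "a \<le> 1" "0 \<le> b" "b \<le> 1" "C (bern a) (bern b) \<le> D \<rho> \<sigma>"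
proof -
  have E: "cptp n 2 (test_channel L)" by (rule test_channel_cptp[OF L])
  have dL: "dim_row L = n" using L(1) by (auto simp: psd_def)
  have *: "0 \<le> Re (mat_trace (L * X)) \<and> Re (mat_trace (L * X)) \<le> 1 \<and>
      test_channel L X = diag_op 2 (bern (Re (mat_trace (L * X))))" if X: "density_op n X" for X
  proof -
    have pX: "psd n X" and tX: "mat_trace X = 1" and "X \<in> carrier_mat n n"
      using X by (auto simp: density_op_def psd_def)
    then have "mat_trace (test_channel L X) = 1" using E by (simp add: cptp_def)
    then have sum: "mat_trace (L * X) + mat_trace ((1\<^sub>m n - L) * X) = 1"
      by (simp add: test_channel_def mat_trace_mat_diag lessThan_nat_numeral dL add.commute)
    have ge: "0 \<le> mat_trace (L * X)" "0 \<le> mat_trace ((1\<^sub>m n - L) * X)"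
      using psd_trace_mult L pX by auto
    define x where "x = Re (mat_trace (L * X))"
    \<comment> \<open>A nonnegative complex number is real, so \<open>Re\<close> loses nothing
      here.\<close>
    have x: "mat_trace (L * X) = complex_of_real x"
      using ge(1) by (auto simp: x_def less_eq_complex_def complex_eq_iff)
    have x': "mat_trace ((1\<^sub>m n - L) * X) = complex_of_real (1 - x)"
      using sum unfolding x by (simp add: eq_diff_eq add.commute)
    have "test_channel L X = diag_op 2 (bern x)"
      by (intro eq_matI) (auto simp: test_channel_def diag_op_def mat_diag_def bern_def dL x x')
    moreover have "0 \<le> x" "x \<le> 1"
      using ge unfolding x x' by (auto simp: less_eq_complex_def)
    ultimately show ?thesis by (simp add: x_def)
  qed
  show ab: "0 \<le> a" "a \<le> 1" "0 \<le> b" "b \<le> 1"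
    using *[OF rho] *[OF sigma] by (auto simp: a_def b_def)
  have "C (bern a) (bern b) = D (test_channel L \<rho>) (test_channel L \<sigma>)"
    using *[OF rho] *[OF sigma] quantum_extension_diag_op[OF D prob_vec_bern[OF ab(1,2)] prob_vec_bern[OF ab(3,4)]]
    by (simp add: a_def b_def)
  also have "\<dots> \<le> D \<rho> \<sigma>"
    using D E rho sigma by (auto simp: quantum_extension_def quantum_divergence_def)
  finally show "C (bern a) (bern b) \<le> D \<rho> \<sigma>" .
qed

section \<open>Binary distributions\<close>

text \<open>The real form of \<alpha> / (\<alpha> - 1). Infinity needs its own case:
  \<open>real_of_ereal\<close> maps it to 0, so the quotient would be 0 instead of the limit
  1.\<close>

definition renyi_factor :: "ereal \<Rightarrow> real" where
  "renyi_factor \<alpha> = (if \<alpha> = \<infinity> then 1 else real_of_ereal \<alpha> / (real_of_ereal \<alpha> - 1))"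

lemma supp_bern: "supp (bern a) = (if a = 0 then {} else {0}) \<union> (if a = 1 then {} else {1})"
  by (auto simp: supp_def bern_def less_2_cases_iff)

lemma dim_bern [simp]: "dim_vec (bern a) = 2"
  by (simp add: bern_def)

lemma index_bern [simp]: "bern a $ 0 = a" "bern a $ Suc 0 = 1 - a"
  by (simp_all add: bern_def)

text \<open>A finite divergence forces inclusion of supports, hence \<open>b > 0\<close>. Discarding
  outcome 1 only lowers the sum or the maximum, and the prefactor \<open>1 / (r - 1)\<close> is
  positive.\<close>

lemma renyi_div_bern_lower:
  assumes "1 < \<alpha>" "0 < a" "a \<le> 1" "0 \<le> b" "b \<le> 1"
    and le: "renyi_div \<alpha> (bern a) (bern b) \<le> ereal d"
  shows "0 < b \<and> renyi_factor \<alpha> * log 2 a - log 2 b \<le> d"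
proof -
  have supp: "supp (bern a) \<subseteq> supp (bern b)"
    using le assms(1) by (auto simp: renyi_div_def split: if_splits)
  then have b: "0 < b" using assms(2,4) by (auto simp: supp_bern split: if_splits)
  have \<alpha>: "\<not> \<alpha> < 1" "\<alpha> \<noteq> 0" "\<alpha> \<noteq> 1" using assms(1) by auto
  show ?thesis
  proof (cases "\<alpha> = \<infinity>")
    case True
    have "a / b \<le> Max ((\<lambda>i. bern a $ i / bern b $ i) ` supp (bern a))"
      using assms(2) by (intro Max_ge) (auto simp: supp_bern)
    moreover have "0 < a / b" using assms(2) b by simp
    ultimately have "log 2 (a / b) \<le> log 2 (Max ((\<lambda>i. bern a $ i / bern b $ i) ` supp (bern a)))"
      by (subst log_le_cancel_iff) auto
    also have "\<dots> \<le> d" using le supp \<alpha> True by (simp add: renyi_div_def)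
    finally show ?thesis using assms(2) b True by (simp add: renyi_factor_def log_divide)
  next
    case False
    then obtain r where r: "\<alpha> = ereal r" "1 < r" using assms(1) by (cases \<alpha>) auto
    define t where "t = a powr r * b powr (1 - r)"
    have t: "0 < t" using assms(2) b by (simp add: t_def)
    have "1 / (r - 1) * log 2 t \<le>
        1 / (r - 1) * log 2 (\<Sum>i<2. (bern a $ i) powr r * (bern b $ i) powr (1 - r))"
      using t r(2) by (intro mult_left_mono log_mono) (auto simp: t_def numeral_2_eq_2)
    also have "\<dots> \<le> d"
      using le supp \<alpha> r by (simp add: renyi_div_def)
    also have "log 2 t = r * log 2 a + (1 - r) * log 2 b"
      using assms(2) b by (simp add: t_def log_mult log_powr)
    also have "1 / (r - 1) * \<dots> = renyi_factor \<alpha> * log 2 a - log 2 b"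
      using r by (simp add: renyi_factor_def field_simps)
    finally show ?thesis using b by simp
  qed
qed

text \<open>The projector onto outcome 0 accepts the first state with probability exactly
  \<open>1 - \<epsilon>\<close> and the second with probability \<open>b\<close>.\<close>

lemma hyp_test_min_bern:
  assumes "0 < \<epsilon>" "\<epsilon> < 1" "0 \<le> b" "b \<le> 1"
  defines "m \<equiv> hyp_test_min \<epsilon> (diag_op 2 (bern (1 - \<epsilon>))) (diag_op 2 (bern b))"
  shows "0 \<le> m" "m \<le> b"
proof -
  let ?\<rho> = "diag_op 2 (bern (1 - \<epsilon>))" and ?\<sigma> = "diag_op 2 (bern b)"
  let ?S = "{Re (mat_trace (L * ?\<sigma>)) | L.
     psd (dim_row ?\<rho>) L \<and> psd (dim_row ?\<rho>) (1\<^sub>m (dim_row ?\<rho>) - L) \<and> 1 - \<epsilon> \<le> Re (mat_trace (L * ?\<rho>))}"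
  have dim: "dim_row ?\<rho> = 2" by (simp add: diag_op_def mat_diag_def)
  have sigma: "psd 2 ?\<sigma>"
    using density_op_diag_op[OF prob_vec_bern[OF assms(3,4)]] by (simp add: density_op_def)
  \<comment> \<open>This projector and its complement \<open>diag_op 2 (bern 0)\<close> are
    themselves density operators, hence positive.\<close>
  let ?L = "diag_op 2 (bern 1)"
  have L: "psd 2 ?L" using density_op_diag_op[OF prob_vec_bern[of 1]] by (simp add: density_op_def)
  have "1\<^sub>m 2 - ?L = diag_op 2 (bern 0)"
    by (intro eq_matI) (auto simp: diag_op_def mat_diag_def less_2_cases_iff)
  then have L': "psd 2 (1\<^sub>m 2 - ?L)"
    using density_op_diag_op[OF prob_vec_bern[of 0]] by (simp add: density_op_def)
  have tr: "mat_trace (?L * diag_op 2 (bern x)) = complex_of_real x" for x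
    by (simp add: diag_op_def mat_trace_mat_diag numeral_2_eq_2)
  have b: "b \<in> ?S"
    using L L' tr[of b] tr[of "1 - \<epsilon>"] unfolding dim by (auto intro!: exI[of _ ?L])
  have nonneg: "0 \<le> x" if "x \<in> ?S" for x
    using that psd_trace_mult[OF _ sigma] unfolding dim by (auto simp: less_eq_complex_def)
  show "0 \<le> m" unfolding m_def hyp_test_min_def
    using b nonneg by (intro cInf_greatest) blast+
  show "m \<le> b" unfolding m_def hyp_test_min_def
    using b nonneg by (intro cInf_lower bdd_belowI[of _ 0]) blast+
qed

lemma hyp_test_div_bern_ge:
  assumes "0 < \<epsilon>" "\<epsilon> < 1" "0 < b" "b \<le> 1"
  shows "ereal (- log 2 b) \<le> hyp_test_div \<epsilon> (diag_op 2 (bern (1 - \<epsilon>))) (diag_op 2 (bern b))"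
  using hyp_test_min_bern[OF assms(1,2), of b] assms by (auto simp: hyp_test_div_def)

lemma hyp_test_div_bern_zero:
  assumes "0 < \<epsilon>" "\<epsilon> < 1"
  shows "hyp_test_div \<epsilon> (diag_op 2 (bern (1 - \<epsilon>))) (diag_op 2 (bern 0)) = \<infinity>"
  using hyp_test_min_bern[OF assms, of 0] by (auto simp: hyp_test_div_def)

text \<open>Each \<open>b\<close> yields one lower bound on the constant; finiteness of
  \<open>d\<close> allows it to be moved to the other side.\<close>

lemma mu_H_bern_ge:
  assumes D: "quantum_extension (renyi_div \<alpha>) D" and \<epsilon>: "0 < \<epsilon>" "\<epsilon> < 1" and b: "0 < b" "b \<le> 1"
    and "renyi_div \<alpha> (bern (1 - \<epsilon>)) (bern b) = ereal d"
  shows "ereal (- log 2 b - d) \<le> mu_H \<epsilon> D"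
proof -
  let ?\<rho> = "diag_op 2 (bern (1 - \<epsilon>))" and ?\<sigma> = "diag_op 2 (bern b)"
  have pv: "prob_vec 2 (bern (1 - \<epsilon>))" "prob_vec 2 (bern b)"
    using \<epsilon> b by (auto intro: prob_vec_bern)
  have "hyp_test_div \<epsilon> ?\<rho> ?\<sigma> \<le> D ?\<rho> ?\<sigma> + mu_H \<epsilon> D"
    using D pv[THEN density_op_diag_op] mu_H_le_iff[of D \<epsilon> "mu_H \<epsilon> D"]
    unfolding quantum_extension_def by blast
  then have "ereal (- log 2 b) \<le> ereal d + mu_H \<epsilon> D"
    using hyp_test_div_bern_ge[OF \<epsilon> b] quantum_extension_diag_op[OF D pv] assms(6) by simp
  then show ?thesis by (cases "mu_H \<epsilon> D") auto
qed


section \<open>The optimal constant\<close>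

text \<open>If \<open>D \<rho> \<sigma>\<close> is finite, all admissible tests accept \<sigma> with
  probability at least \<open>2 powr (- T)\<close>, and so does the infimum.\<close>

lemma hyp_test_div_le:
  assumes D: "quantum_extension (renyi_div \<alpha>) D" and \<epsilon>: "0 < \<epsilon>" "\<epsilon> < 1" and \<alpha>: "1 < \<alpha>"
    and rho: "density_op n \<rho>" and sigma: "density_op n \<sigma>"
  shows "hyp_test_div \<epsilon> \<rho> \<sigma> \<le> D \<rho> \<sigma> + ereal (renyi_factor \<alpha> * log 2 (1 / (1 - \<epsilon>)))"
proof (cases "D \<rho> \<sigma>")
  case MInf
  then show ?thesis
    using D rho sigma by (auto simp: quantum_extension_def quantum_divergence_def)
next
  case (real d)
  define T where "T = d + renyi_factor \<alpha> * log 2 (1 / (1 - \<epsilon>))"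
  have carrier: "\<rho> \<in> carrier_mat n n" using rho by (simp add: density_op_def psd_def)
  then have dim: "dim_row \<rho> = n" by simp
  \<comment> \<open>The sign lets the acceptance probability \<open>a\<close> be replaced by its
    lower bound \<open>1 - \<epsilon>\<close>.\<close>
  have factor: "0 \<le> renyi_factor \<alpha>"
    using \<alpha> by (cases \<alpha>) (auto simp: renyi_factor_def)
  have bound: "2 powr (- T) \<le> b"
    if L: "psd n L" "psd n (1\<^sub>m n - L)" and a: "1 - \<epsilon> \<le> Re (mat_trace (L * \<rho>))"
      and b_def: "b = Re (mat_trace (L * \<sigma>))" for L b
  proof -
    define a where "a = Re (mat_trace (L * \<rho>))"
    note t = test_data_processing[OF D rho sigma L, folded a_def b_def]
    have a': "1 - \<epsilon> \<le> a" "0 < a" using a \<epsilon> by (auto simp: a_def)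
    have b: "0 < b" "renyi_factor \<alpha> * log 2 a - log 2 b \<le> d"
      using renyi_div_bern_lower[OF \<alpha> a'(2) t(2-4)] t(5) real by auto
    have "renyi_factor \<alpha> * log 2 (1 - \<epsilon>) \<le> renyi_factor \<alpha> * log 2 a"
      using a' \<epsilon> factor by (intro mult_left_mono) auto
    then have "- T \<le> log 2 b" using b(2) \<epsilon> by (simp add: T_def log_divide)
    then show ?thesis using b(1) by (simp add: le_log_iff)
  qed
  have ge: "2 powr (- T) \<le> hyp_test_min \<epsilon> \<rho> \<sigma>"
    unfolding hyp_test_min_def dim
  proof (rule cInf_greatest)
    \<comment> \<open>The identity is an admissible test, so the infimum is over a nonempty
      set.\<close>
    have "psd n (1\<^sub>m n)" 
      unfolding mat_diag_one[symmetric] by (rule psd_mat_diag) (simp add: less_eq_complex_def)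
    moreover have "psd n (1\<^sub>m n - 1\<^sub>m n)"
      using minus_carrier_mat[of "1\<^sub>m n" n n "1\<^sub>m n"]
      by (simp add: psd_iff_pos_form pos_form_def qform_def)
    moreover have "1 - \<epsilon> \<le> Re (mat_trace (1\<^sub>m n * \<rho>))"
      using rho carrier \<epsilon> by (simp add: density_op_def)
    ultimately show "{Re (mat_trace (L * \<sigma>)) | L. psd n L \<and> psd n (1\<^sub>m n - L) \<and>
        1 - \<epsilon> \<le> Re (mat_trace (L * \<rho>))} \<noteq> {}"
      by blast
  qed (use bound in blast)
  \<comment> \<open>Positivity excludes the infinite branch of \<open>hyp_test_div\<close>.\<close>
  then have pos: "0 < hyp_test_min \<epsilon> \<rho> \<sigma>"
    by (rule less_le_trans[rotated]) simp
  then have "- T \<le> log 2 (hyp_test_min \<epsilon> \<rho> \<sigma>)"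
    using ge by (simp add: le_log_iff)
  then show ?thesis using real pos by (simp add: hyp_test_div_def T_def)
qed simp

text \<open>Two equal states have divergence 0, yet a test may reject with probability \<epsilon>,
  which leaves the hypothesis testing divergence at least
  \<open>- log 2 (1 - \<epsilon>)\<close>.\<close>

lemma mu_H_renyi_infinity_ge:
  assumes D: "quantum_extension (renyi_div \<infinity>) D" and \<epsilon>: "0 < \<epsilon>" "\<epsilon> < 1"
  shows "ereal (log 2 (1 / (1 - \<epsilon>))) \<le> mu_H \<epsilon> D"
proof -
  have "renyi_div \<infinity> (bern (1 - \<epsilon>)) (bern (1 - \<epsilon>)) = ereal 0"
    using \<epsilon> by (simp add: renyi_div_def supp_bern)
  from mu_H_bern_ge[OF D \<epsilon> _ _ this] show ?thesis
    using \<epsilon> by (simp add: log_divide)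
qed

lemma mu_H_renyi_gt_1_ge:
  assumes D: "quantum_extension (renyi_div (ereal r)) D" and \<epsilon>: "0 < \<epsilon>" "\<epsilon> < 1" and r: "1 < r"
  shows "ereal (r / (r - 1) * log 2 (1 / (1 - \<epsilon>))) \<le> mu_H \<epsilon> D"
proof -
  \<comment> \<open>The bound \<open>- log 2 b - d\<close> with \<open>log 2 b\<close> absorbed into
    the logarithm of the sum: both terms diverge as \<open>b\<close> tends to 0, but the combined
    argument has a positive limit.\<close>
  define f where "f b = - (1 / (r - 1)) *
    log 2 ((1 - \<epsilon>) powr r + \<epsilon> powr r * (1 - b) powr (1 - r) * b powr (r - 1))" for b
  have ge: "ereal (f b) \<le> mu_H \<epsilon> D" if b: "0 < b" "b < 1" for b
  proof -
    define S where "S = (1 - \<epsilon>) powr r * b powr (1 - r) + \<epsilon> powr r * (1 - b) powr (1 - r)"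
    have S: "0 < S" using \<epsilon> b by (auto simp: S_def intro!: add_pos_pos)
    have "renyi_div (ereal r) (bern (1 - \<epsilon>)) (bern b) = ereal (1 / (r - 1) * log 2 S)"
      using \<epsilon> b r by (simp add: renyi_div_def supp_bern S_def numeral_2_eq_2)
    from mu_H_bern_ge[OF D \<epsilon> b(1) _ this] b
    have "ereal (- log 2 b - 1 / (r - 1) * log 2 S) \<le> mu_H \<epsilon> D" by simp
    moreover have "f b = - log 2 b - 1 / (r - 1) * log 2 S"
    proof -
      have "(1 - \<epsilon>) powr r + \<epsilon> powr r * (1 - b) powr (1 - r) * b powr (r - 1) = S * b powr (r - 1)"
        using b by (simp add: S_def algebra_simps flip: powr_add)
      moreover have "log 2 (S * b powr (r - 1)) = log 2 S + (r - 1) * log 2 b"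
        using S b by (simp add: log_mult log_powr)
      ultimately have "f b = - (1 / (r - 1)) * (log 2 S + (r - 1) * log 2 b)"
        by (simp only: f_def)
      then show ?thesis using r by (simp add: field_simps)
    qed
    ultimately show ?thesis by simp
  qed
  have "((\<lambda>b. b powr (r - 1)) \<longlongrightarrow> 0) (at_right 0)"
    using r eventually_at_right_less[of "0 :: real"]
    by (intro tendsto_zero_powrI[where b = "r - 1"] tendsto_ident_at tendsto_const) (auto elim: eventually_mono)
  \<comment> \<open>The limit is left unsimplified, with \<open>1 - 0\<close> and a final factor 0,
    to match the shape of \<open>f\<close> for \<open>tendsto_intros\<close>.\<close>
  then have "(f \<longlongrightarrow> - (1 / (r - 1)) *
      log 2 ((1 - \<epsilon>) powr r + \<epsilon> powr r * (1 - 0) powr (1 - r) * 0)) (at_right 0)"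
    unfolding f_def using \<epsilon> by (intro tendsto_intros) auto
  moreover have "- (1 / (r - 1)) * log 2 ((1 - \<epsilon>) powr r + \<epsilon> powr r * (1 - 0) powr (1 - r) * 0)
      = r / (r - 1) * log 2 (1 / (1 - \<epsilon>))"
    using \<epsilon> by (simp add: log_powr log_divide)
  ultimately have "((\<lambda>b. ereal (f b)) \<longlongrightarrow> ereal (r / (r - 1) * log 2 (1 / (1 - \<epsilon>)))) (at_right 0)"
    by simp
  moreover have "\<forall>\<^sub>F b in at_right 0. ereal (f b) \<le> mu_H \<epsilon> D"
    using eventually_at_right_real[of 0 1] by (rule eventually_mono) (use ge in auto)
  ultimately show ?thesis by (rule tendsto_upperbound) simp
qed

text \<open>With \<open>b = 2 powr (- t)\<close> the hypothesis testing divergence is at least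
  \<open>t\<close>, while relative entropy grows only like \<open>(1 - \<epsilon>) * t\<close>; the
  gap \<open>\<epsilon> * t\<close> is unbounded.\<close>

lemma mu_H_renyi_1:
  assumes D: "quantum_extension (renyi_div 1) D" and \<epsilon>: "0 < \<epsilon>" "\<epsilon> < 1"
  shows "mu_H \<epsilon> D = \<infinity>"
proof -
  have "ereal M \<le> mu_H \<epsilon> D" for M
  proof -
    \<comment> \<open>The quotient \<open>M / \<epsilon>\<close> yields \<open>M\<close>, the added
      1 pays for \<open>\<epsilon> * log 2 (1 - b) \<ge> - \<epsilon>\<close>, and
      \<open>t \<ge> 1\<close> ensures \<open>b \<le> 1 / 2\<close>.\<close>
    define t where "t = max 1 (M / \<epsilon> + 1)"
    define b :: real where "b = 2 powr (- t)"
    have "b \<le> 2 powr (- 1)" unfolding b_def by (intro powr_mono) (auto simp: t_def)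
    then have b: "0 < b" "b \<le> 1 / 2" by (auto simp: b_def powr_minus)
    have "renyi_div 1 (bern (1 - \<epsilon>)) (bern b) =
        ereal ((1 - \<epsilon>) * log 2 ((1 - \<epsilon>) / b) + \<epsilon> * log 2 (\<epsilon> / (1 - b)))"
      using \<epsilon> b by (simp add: renyi_div_def supp_bern)
    from mu_H_bern_ge[OF D \<epsilon> b(1) _ this] b
    have "ereal (- log 2 b - ((1 - \<epsilon>) * log 2 ((1 - \<epsilon>) / b) + \<epsilon> * log 2 (\<epsilon> / (1 - b)))) \<le> mu_H \<epsilon> D"
      by simp
    moreover have "M \<le> - log 2 b - ((1 - \<epsilon>) * log 2 ((1 - \<epsilon>) / b) + \<epsilon> * log 2 (\<epsilon> / (1 - b)))"
    proof -
      have "log 2 (1 / 2) \<le> log 2 (1 - b)" using b by (subst log_le_cancel_iff) auto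
      then have 1: "\<epsilon> * (- 1) \<le> \<epsilon> * log 2 (1 - b)"
        using \<epsilon> by (intro mult_left_mono) (auto simp: log_divide)
      have 2: "(1 - \<epsilon>) * log 2 (1 - \<epsilon>) \<le> 0" "\<epsilon> * log 2 \<epsilon> \<le> 0"
        using \<epsilon> by (auto intro!: mult_nonneg_nonpos)
      have "\<epsilon> * (M / \<epsilon> + 1) \<le> \<epsilon> * t" using \<epsilon> by (intro mult_left_mono) (auto simp: t_def)
      then have 3: "M + \<epsilon> \<le> \<epsilon> * t" using \<epsilon> by (simp add: distrib_left)
      have "log 2 b = - t" by (simp add: b_def)
      then have "- log 2 b - ((1 - \<epsilon>) * log 2 ((1 - \<epsilon>) / b) + \<epsilon> * log 2 (\<epsilon> / (1 - b))) =
          \<epsilon> * t - (1 - \<epsilon>) * log 2 (1 - \<epsilon>) - \<epsilon> * log 2 \<epsilon> + \<epsilon> * log 2 (1 - b)"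
        using \<epsilon> b by (simp add: log_divide algebra_simps)
      then show ?thesis using 1 2 3 by simp
    qed
    ultimately show ?thesis by (meson ereal_less_eq(3) order_trans)
  qed
  then show ?thesis by (simp add: ereal_top)
qed

text \<open>At \<open>b = 0\<close> both states charge outcome 1, so the divergence is finite, but
  accepting on outcome 0 never accepts the second state.\<close>

lemma mu_H_renyi_less_1:
  assumes D: "quantum_extension (renyi_div \<alpha>) D" and \<epsilon>: "0 < \<epsilon>" "\<epsilon> < 1" and \<alpha>: "0 \<le> \<alpha>" "\<alpha> < 1"
  shows "mu_H \<epsilon> D = \<infinity>"
proof -
  let ?\<rho> = "diag_op 2 (bern (1 - \<epsilon>))" and ?\<sigma> = "diag_op 2 (bern 0)"
  have pv: "prob_vec 2 (bern (1 - \<epsilon>))" "prob_vec 2 (bern 0)"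
    using \<epsilon> by (auto intro: prob_vec_bern)
  have "supp (bern (1 - \<epsilon>)) \<inter> supp (bern 0) \<noteq> {}" using \<epsilon> by (simp add: supp_bern)
  moreover have "\<not> 1 \<le> \<alpha>" "\<alpha> \<noteq> 1" "\<alpha> \<noteq> \<infinity>" using \<alpha> by auto
  ultimately have "\<exists>d. renyi_div \<alpha> (bern (1 - \<epsilon>)) (bern 0) = ereal d"
    by (cases "\<alpha> = 0") (simp_all add: renyi_div_def Let_def)
  then obtain d where "renyi_div \<alpha> (bern (1 - \<epsilon>)) (bern 0) = ereal d" ..
  then have "D ?\<rho> ?\<sigma> = ereal d" using quantum_extension_diag_op[OF D pv] by simp
  moreover have "hyp_test_div \<epsilon> ?\<rho> ?\<sigma> \<le> D ?\<rho> ?\<sigma> + mu_H \<epsilon> D"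
    using D pv[THEN density_op_diag_op] mu_H_le_iff[of D \<epsilon> "mu_H \<epsilon> D"]
    unfolding quantum_extension_def by blast
  ultimately show ?thesis
    using hyp_test_div_bern_zero[OF \<epsilon>] by (cases "mu_H \<epsilon> D") auto
qed

theorem theorem3:
  fixes \<epsilon> :: real and \<alpha> :: ereal
    and D :: "complex mat \<Rightarrow> complex mat \<Rightarrow> ereal"
  assumes "0 < \<epsilon>" and "\<epsilon> < 1"
    and "0 \<le> \<alpha>"
    and "quantum_extension (renyi_div \<alpha>) D"
  shows "mu_H \<epsilon> D =
    (if \<alpha> > 1 then (if \<alpha> = \<infinity> then 1 else \<alpha> / (\<alpha> - 1)) * ereal (log 2 (1 / (1 - \<epsilon>)))
     else \<infinity>)"
proof (cases "1 < \<alpha>")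
  case True
  have "mu_H \<epsilon> D \<le> ereal (renyi_factor \<alpha> * log 2 (1 / (1 - \<epsilon>)))"
    using assms(4) hyp_test_div_le[OF assms(4,1,2) True]
    by (subst mu_H_le_iff) (auto simp: quantum_extension_def)
  moreover have "ereal (renyi_factor \<alpha> * log 2 (1 / (1 - \<epsilon>))) \<le> mu_H \<epsilon> D"
  proof (cases "\<alpha> = \<infinity>")
    case inf: True
    then show ?thesis
      using mu_H_renyi_infinity_ge[of D \<epsilon>] assms by (simp add: renyi_factor_def)
  next
    case False
    then obtain r where "\<alpha> = ereal r" "1 < r" using True by (cases \<alpha>) auto
    then show ?thesis
      using mu_H_renyi_gt_1_ge[of r D \<epsilon>] assms by (simp add: renyi_factor_def)
  qed
  \<comment> \<open>For finite \<alpha> the denominator is a nonzero real, so the extended and the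
    real quotient agree.\<close>
  moreover have "(if \<alpha> = \<infinity> then 1 else \<alpha> / (\<alpha> - 1)) * ereal (log 2 (1 / (1 - \<epsilon>))) =
      ereal (renyi_factor \<alpha> * log 2 (1 / (1 - \<epsilon>)))"
    using True by (cases \<alpha>) (auto simp: renyi_factor_def one_ereal_def)
  ultimately show ?thesis using True by simp
next
  case False
  then have "\<alpha> < 1 \<or> \<alpha> = 1" by auto
  then show ?thesis
    using mu_H_renyi_less_1[OF assms(4,1,2,3)] mu_H_renyi_1[of D \<epsilon>] assms False by auto
qed

end
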